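(* Let $\alpha$ be a positive integer, let $0<p=1-q<1$, and for real $z$ let $g_z$ be the solution (given explicitly in the context) of the Stein equation for the binomial distribution with parameters $\alpha,p$ and the call function $x\mapsto (x-z)^+$. Write $\Delta g_z(k)=g_z(k+1)-g_z(k)$. Then for every real $z\ge 0$ and every integer $0\le k\le \alpha$, $$|\Delta g_z (k)|\le \begin{cases} 2q^{1-\alpha}-q, & \text{for } k=0;\\ 2q^{k-\alpha}, & \text{for } 1\le k \le \alpha.\end{cases}$$
   Context: $x^+=\max\{x,0\}$. $\mathrm{B}_{\alpha,p}$ denotes a binomial random variable: $\mathbb{P}(\mathrm{B}_{\alpha,p}=k)=\binom{\alpha}{k}p^kq^{\alpha-k}$, $k=0,1,\ldots,\alpha$, where $\alpha$ is a positive integer and $0<p=1-q<1$. The Stein equation is $$\frac{(\alpha-k)p}{q}g_z(k+1)-k\,g_z(k)=(k-z)^+-\mathbb{E}[(\mathrm{B}_{\alpha,p}-z)^+],\qquad k=0,1,\ldots,\alpha,$$ and $g_z$ is its solution given by $g_z(0)=0$ and, for $1\le k\le\alpha$, $$g_z(k)=-\sum_{j=k}^{\alpha}\frac{(\alpha-k)!}{(\alpha-j)!}\frac{(k-1)!}{j!}\left(\frac{p}{q}\right)^{j-k}\left[(j-z)^+-\mathbb{E}[(\mathrm{B}_{\alpha,p}-z)^+]\right],$$ with the convention $g_z(\alpha+1)=0$. *)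

theory Defs
  imports "HOL-Probability.Probability"
begin

definition call :: "real \<Rightarrow> real \<Rightarrow> real" where
  "call z x = max (x - z) 0"

definition binomial_call_mean :: "nat \<Rightarrow> real \<Rightarrow> real \<Rightarrow> real" where
  "binomial_call_mean \<alpha> p z =
     measure_pmf.expectation (binomial_pmf \<alpha> p) (\<lambda>k. call z (real k))"

text \<open>
  The solution \<open>g\<^sub>z\<close> of the binomial Stein equation
  \<open>((\<alpha> - k) p / q) g (k + 1) - k g k = call z k - E (call z B)\<close> for \<open>k = 0, \<dots>, \<alpha>\<close>,
  where \<open>q = 1 - p\<close>.  The values \<open>g 0 = 0\<close> and \<open>g (\<alpha> + 1) = 0\<close> are conventions,
  since the equation does not determine them; arguments beyond \<open>\<alpha> + 1\<close> are
  irrelevant and also mapped to 0.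
\<close>

definition stein_sol :: "nat \<Rightarrow> real \<Rightarrow> real \<Rightarrow> nat \<Rightarrow> real" where
  "stein_sol \<alpha> p z k =
     (if 1 \<le> k \<and> k \<le> \<alpha> then
        - (\<Sum>j=k..\<alpha>. (fact (\<alpha> - k) / fact (\<alpha> - j)) * (fact (k - 1) / fact j)
              * (p / (1 - p)) ^ (j - k)
              * (call z (real j) - binomial_call_mean \<alpha> p z))
      else 0)"

definition fwd_diff :: "(nat \<Rightarrow> real) \<Rightarrow> nat \<Rightarrow> real" where
  "fwd_diff g k = g (k + 1) - g k"

end

theory Submission
  imports Defs
begin

text \<open>
  Write \<open>\<pi>\<close> for the binomial probabilities and \<open>B\<close> for the binomial variable.  The weights in the
  definition of the solution are \<open>\<pi> j / (k * \<pi> k)\<close>, so that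
  \<open>g k = - (\<Sum>j=k..\<alpha>. \<pi> j * (h j - E (h B))) / (k * \<pi> k)\<close> for \<open>1 \<le> k \<le> \<alpha>\<close>, where \<open>h\<close> is the call
  function.  The whole estimate comes from squeezing \<open>g\<close> between two explicit solutions:
  for every \<open>k\<close> one has \<open>-q \<le> g k \<le> 0\<close>, where \<open>0\<close> solves the equation with a constant in place of
  \<open>h\<close>, and the constant \<open>-q\<close> solves it with the identity in place of \<open>h\<close>.

  Both inequalities are instances of one correlation inequality: the mean of a nondecreasing function
  over an upper tail is at least its overall mean (\<open>sum_tail_ge_mean\<close>).  Applied to \<open>h\<close> it gives
  \<open>g \<le> 0\<close>.  Since \<open>h\<close> has slope at most 1, the function \<open>j - h j\<close> is nondecreasing as well, and
  applied to it the inequality bounds the centred tail sum of \<open>h\<close> by that of the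
  identity, which telescopes to \<open>q * k * \<pi> k\<close> (\<open>binomial_tail_centred\<close>).

  Consequently two values of \<open>g\<close> differ by at most \<open>q\<close>, including at the boundary
  points where \<open>g\<close> vanishes by convention.  This is stronger than the stated bounds, because
  the powers of \<open>q\<close> occurring there have nonpositive exponents and hence are at least 1.
\<close>

text \<open>
  A form of Chebyshev's association inequality with an indicator of a tail.  On the tail \<open>f\<close> is at
  least \<open>f k\<close> and off the tail it is at most \<open>f k\<close>, so comparing both parts with \<open>f k\<close> suffices.
\<close>

lemma sum_tail_ge_mean:
  fixes w f :: "nat \<Rightarrow> real"
  assumes nonneg: "\<And>j. j \<le> n \<Longrightarrow> 0 \<le> w j"
    and total: "(\<Sum>j\<le>n. w j) = 1"
    and mono: "\<And>i j. i \<le> j \<Longrightarrow> j \<le> n \<Longrightarrow> f i \<le> f j"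
    and "k \<le> n"
  shows "0 \<le> (\<Sum>j=k..n. w j * (f j - (\<Sum>i\<le>n. w i * f i)))"
proof -
  define T H where "T = (\<Sum>j=k..n. w j)" and "H = (\<Sum>j<k. w j)"
  define Tf Hf where "Tf = (\<Sum>j=k..n. w j * f j)" and "Hf = (\<Sum>j<k. w j * f j)"
  have split: "(\<Sum>j\<le>n. u j) = (\<Sum>j<k. u j) + (\<Sum>j=k..n. u j)" for u :: "nat \<Rightarrow> real"
  proof -
    have "{..n} = {..<k} \<union> {k..n}" using \<open>k \<le> n\<close> by auto
    then show ?thesis by (simp add: sum.union_disjoint ivl_disj_int)
  qed
  have HT: "H = 1 - T" using total split[of w] by (simp add: H_def T_def)
  have "0 \<le> T" "0 \<le> H"
    unfolding T_def H_def using nonneg \<open>k \<le> n\<close> by (auto intro!: sum_nonneg)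
  have "T * f k \<le> Tf"
    unfolding T_def Tf_def sum_distrib_right
    by (intro sum_mono mult_left_mono mono nonneg) auto
  moreover have "Hf \<le> H * f k"
    unfolding H_def Hf_def sum_distrib_right
    using \<open>k \<le> n\<close> by (intro sum_mono mult_left_mono mono nonneg) auto
  ultimately have "H * (T * f k) \<le> H * Tf" "T * Hf \<le> T * (H * f k)"
    using \<open>0 \<le> T\<close> \<open>0 \<le> H\<close> by (auto intro: mult_left_mono)
  then have "0 \<le> H * Tf - T * Hf" by (simp add: mult.left_commute)
  also have "H * Tf - T * Hf = Tf - T * (Hf + Tf)"
    by (simp add: HT algebra_simps)
  also have "\<dots> = (\<Sum>j=k..n. w j * (f j - (\<Sum>i\<le>n. w i * f i)))"
    unfolding split[of "\<lambda>i. w i * f i"] T_def Tf_def Hf_def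
    by (simp add: right_diff_distrib sum_subtractf sum_distrib_right)
  finally show ?thesis .
qed

lemma binomial_pmf_Suc_ratio:
  assumes "0 \<le> p" "p \<le> 1" "j \<le> n"
  shows "(1 - p) * (real (Suc j) * pmf (binomial_pmf n p) (Suc j))
           = (real n - real j) * p * pmf (binomial_pmf n p) j"
proof (cases "j = n")
  case False
  then have "j < n" using assms by simp
  have "Suc j * (n choose Suc j) = (n - j) * (n choose j)"
    by (metis binomial_absorb_comp binomial_absorption)
  then have "real (Suc j) * real (n choose Suc j) = (real n - real j) * real (n choose j)"
    using \<open>j < n\<close> by (metis less_imp_le of_nat_diff of_nat_mult)
  moreover have "(1 - p) ^ (n - j) = (1 - p) * (1 - p) ^ (n - Suc j)"
    using \<open>j < n\<close> by (simp add: Suc_diff_Suc flip: power_Suc)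
  ultimately show ?thesis using assms by simp
qed (use assms in simp)

text \<open>
  By the ratio of consecutive probabilities, \<open>\<pi> j * (j - n * p)\<close> is the decrement at \<open>j\<close> of
  \<open>(1 - p) * j * \<pi> j\<close>, and this quantity vanishes at \<open>n + 1\<close>.
\<close>

lemma binomial_tail_centred:
  assumes "0 \<le> p" "p \<le> 1" "k \<le> n"
  shows "(\<Sum>j=k..n. pmf (binomial_pmf n p) j * (real j - real n * p))
           = (1 - p) * (real k * pmf (binomial_pmf n p) k)"
proof -
  let ?a = "\<lambda>j. (1 - p) * (real j * pmf (binomial_pmf n p) j)"
  have "(\<Sum>j=k..n. pmf (binomial_pmf n p) j * (real j - real n * p))
          = (\<Sum>j=k..n. ?a j - ?a (Suc j))"
    by (rule sum.cong, simp, subst binomial_pmf_Suc_ratio) (use assms in \<open>auto simp: algebra_simps\<close>)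
  also have "\<dots> = ?a k - ?a (Suc n)"
    using assms sum_Suc_diff[of k "Suc n" "\<lambda>j. - ?a j"] by (simp add: sum_Suc_diff)
  also have "\<dots> = ?a k" using assms by simp
  finally show ?thesis .
qed

lemma sum_binomial_pmf:
  assumes "0 \<le> p" "p \<le> 1"
  shows "(\<Sum>j\<le>n. pmf (binomial_pmf n p) j) = 1"
  using assms set_pmf_binomial_eq[of p n]
  by (intro sum_pmf_eq_1) (auto split: if_splits)

lemma binomial_mean:
  assumes "0 \<le> p" "p \<le> 1"
  shows "(\<Sum>j\<le>n. pmf (binomial_pmf n p) j * real j) = real n * p"
proof -
  have "(\<Sum>j\<le>n. pmf (binomial_pmf n p) j * (real j - real n * p)) = 0"
    using binomial_tail_centred[OF assms, of 0 n] by (simp add: atLeast0AtMost)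
  then show ?thesis
    using sum_binomial_pmf[OF assms, of n]
    by (simp add: right_diff_distrib sum_subtractf flip: sum_distrib_right)
qed

lemma binomial_call_mean_eq_sum:
  assumes "0 \<le> p" "p \<le> 1"
  shows "binomial_call_mean n p z = (\<Sum>j\<le>n. pmf (binomial_pmf n p) j * call z (real j))"
  unfolding binomial_call_mean_def
  by (subst integral_measure_pmf_real[of "{..n}"])
     (use assms set_pmf_binomial_eq[of p n] in \<open>auto split: if_splits simp: mult.commute\<close>)

lemma binomial_pmf_tail_ratio:
  assumes "0 < p" "p < 1" "1 \<le> k" "k \<le> j" "j \<le> n"
  shows "(fact (n - k) / fact (n - j)) * (fact (k - 1) / fact j) * (p / (1 - p)) ^ (j - k)
           * (real k * pmf (binomial_pmf n p) k) = pmf (binomial_pmf n p) j"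
proof -
  obtain d where j: "j = k + d" using \<open>k \<le> j\<close> le_Suc_ex by blast
  obtain e where n: "n = j + e" using \<open>j \<le> n\<close> le_Suc_ex by blast
  have "(fact k :: real) = real k * fact (k - 1)"
    using \<open>1 \<le> k\<close> by (simp add: fact_reduce)
  moreover have "real (n choose k) = fact n / (fact k * fact (n - k))"
    "real (n choose j) = fact n / (fact j * fact (n - j))"
    using assms by (auto intro: binomial_fact)
  ultimately show ?thesis
    using assms by (simp add: j n power_add field_simps)
qed

lemma stein_sol_eq_binomial_tail:
  assumes "0 < p" "p < 1" "1 \<le> k" "k \<le> n"
  shows "stein_sol n p z k * (real k * pmf (binomial_pmf n p) k)
           = - (\<Sum>j=k..n. pmf (binomial_pmf n p) j * (call z (real j) - binomial_call_mean n p z))"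
proof -
  have "(\<Sum>j=k..n. (fact (n - k) / fact (n - j)) * (fact (k - 1) / fact j) * (p / (1 - p)) ^ (j - k)
            * (call z (real j) - binomial_call_mean n p z)) * (real k * pmf (binomial_pmf n p) k)
          = (\<Sum>j=k..n. pmf (binomial_pmf n p) j * (call z (real j) - binomial_call_mean n p z))"
    unfolding sum_distrib_right
  proof (rule sum.cong)
    fix j assume "j \<in> {k..n}"
    then show "(fact (n - k) / fact (n - j)) * (fact (k - 1) / fact j) * (p / (1 - p)) ^ (j - k)
            * (call z (real j) - binomial_call_mean n p z) * (real k * pmf (binomial_pmf n p) k)
          = pmf (binomial_pmf n p) j * (call z (real j) - binomial_call_mean n p z)"
      using binomial_pmf_tail_ratio[OF assms(1-3), of j n, symmetric]
      by (simp only: atLeastAtMost_iff) (simp only: mult_ac)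
  qed simp
  then show ?thesis using assms by (simp add: stein_sol_def)
qed

text \<open>
  The call function and its complement \<open>x - call z x = min x z\<close> are both nondecreasing; the upper
  bound uses the former, the lower bound the latter.
\<close>

lemma stein_sol_bounds:
  assumes p: "0 < p" "p < 1"
  shows "- (1 - p) \<le> stein_sol n p z k" and "stein_sol n p z k \<le> 0"
proof -
  have "- (1 - p) \<le> stein_sol n p z k \<and> stein_sol n p z k \<le> 0"
  proof (cases "1 \<le> k \<and> k \<le> n")
    case False
    then have "stein_sol n p z k = 0" unfolding stein_sol_def by (rule if_not_P)
    then show ?thesis using p by simp
  next
    case True
    let ?w = "pmf (binomial_pmf n p)" and ?\<mu> = "binomial_call_mean n p z"
    define c where "c = real k * ?w k"
    have "0 < c" using True p by (simp add: c_def)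
    have \<mu>: "?\<mu> = (\<Sum>j\<le>n. ?w j * call z (real j))"
      using p by (simp add: binomial_call_mean_eq_sum)
    have tail: "0 \<le> (\<Sum>j=k..n. ?w j * (f j - (\<Sum>i\<le>n. ?w i * f i)))"
      if "\<And>i j. i \<le> j \<Longrightarrow> f i \<le> f j" for f :: "nat \<Rightarrow> real"
      using that True p by (intro sum_tail_ge_mean) (auto simp: sum_binomial_pmf simp del: pmf_binomial)
    have "0 \<le> (\<Sum>j=k..n. ?w j * (call z (real j) - ?\<mu>))"
      unfolding \<mu> by (rule tail) (auto simp: call_def)
    then have "stein_sol n p z k * c \<le> 0 * c"
      using stein_sol_eq_binomial_tail[of p k n z] p True by (simp add: c_def)
    moreover have "- (1 - p) * c \<le> stein_sol n p z k * c"
    proof -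
      have mean: "(\<Sum>i\<le>n. ?w i * (real i - call z (real i))) = real n * p - ?\<mu>"
        using binomial_mean[of p n] p by (simp add: \<mu> right_diff_distrib sum_subtractf)
      have "0 \<le> (\<Sum>j=k..n. ?w j * ((real j - call z (real j)) - (real n * p - ?\<mu>)))"
        unfolding mean[symmetric] by (rule tail) (auto simp: call_def)
      also have "\<dots> = (\<Sum>j=k..n. ?w j * (real j - real n * p))
                       - (\<Sum>j=k..n. ?w j * (call z (real j) - ?\<mu>))"
        by (simp add: algebra_simps flip: sum_subtractf)
      finally show ?thesis
        using stein_sol_eq_binomial_tail[of p k n z] binomial_tail_centred[of p k n] p True
        by (simp add: c_def del: pmf_binomial minus_diff_eq)
    qed
    ultimately show ?thesis
      using \<open>0 < c\<close> mult_le_cancel_right_pos by blast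
  qed
  then show "- (1 - p) \<le> stein_sol n p z k" and "stein_sol n p z k \<le> 0" by auto
qed

theorem lemma2p1:
  fixes \<alpha> k :: nat and p q z :: real
  assumes "\<alpha> \<ge> 1"
    and "0 < p" and "p = 1 - q" and "p < 1"
    and "z \<ge> 0"
    and "k \<le> \<alpha>"
  shows "\<bar>fwd_diff (stein_sol \<alpha> p z) k\<bar>
           \<le> (if k = 0 then 2 * q powi (1 - int \<alpha>) - q
              else 2 * q powi (int k - int \<alpha>))"
proof -
  have q: "0 < q" "q \<le> 1" and qp: "1 - p = q" using assms by auto
  have "\<bar>fwd_diff (stein_sol \<alpha> p z) k\<bar> \<le> q"
    using stein_sol_bounds[of p \<alpha> z k] stein_sol_bounds[of p \<alpha> z "k + 1"] assms(2,4)
    by (simp add: fwd_diff_def qp)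
  moreover have ge1: "1 \<le> q powi m" if "m \<le> 0" for m :: int
    using that q by (simp add: power_int_def power_le_one one_le_inverse_iff flip: power_inverse)
  moreover have "1 \<le> q powi (1 - int \<alpha>)" "1 \<le> q powi (int k - int \<alpha>)"
    using assms(1,6) by (auto intro!: ge1)
  ultimately show ?thesis
    using q by (cases "k = 0"; simp; linarith)
qed

end
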